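(* There exist infinitely many odd GA1 numbers.
   Context: For an integer $n>1$ let $G(n)=\dfrac{\sigma(n)}{n\log\log n}$, where $\sigma(n)=\sum_{d\mid n}d$. A GA1 number is a composite integer $N$ such that $G(N)\ge G(N/p)$ for every prime $p$ dividing $N$. *)

theory Defs
  imports "HOL-Analysis.Analysis" "HOL-Computational_Algebra.Primes"
begin

definition sigma :: "nat \<Rightarrow> nat" where
  "sigma n = (\<Sum>d | d dvd n. d)"

text \<open>
  Meaningful for \<open>n > 1\<close> only. Note that \<open>gronwall 2 < 0\<close>, because \<open>ln 2 < 1\<close>.
\<close>

definition gronwall :: "nat \<Rightarrow> real" where
  "gronwall n = real (sigma n) / (real n * ln (ln (real n)))"

definition composite :: "nat \<Rightarrow> bool" where
  "composite n \<longleftrightarrow> n > 1 \<and> \<not> prime n"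

text \<open>
  Since \<open>N\<close> is composite and \<open>p\<close> is a prime divisor, \<open>N div p\<close> is an exact quotient
  and exceeds 1, so \<open>gronwall\<close> is only used where it is meaningful.
\<close>

definition GA1 :: "nat \<Rightarrow> bool" where
  "GA1 N \<longleftrightarrow> composite N \<and> (\<forall>p. prime p \<and> p dvd N \<longrightarrow> gronwall N \<ge> gronwall (N div p))"

end

(* Let psi be Chebyshev's function. Put a(p) = floor(log_p(1.21 x)) for the odd primes p <= x and
   let N be the product of the p^a(p). Compared with the odd part of lcm(1..x), the number N also
   contains one more factor p for each prime power m = p^j with sqrt x < m <= 1.1 sqrt x, whence
   ln N >= psi(x) + psi(1.1 sqrt x) - psi(sqrt x) - ln(1.21 x).
   The inequality G(N) >= G(N/p) follows from (p + ... + p^a) ln p <= z ln z with z = ln(N/p).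
   The left side is at most x ln x: clear if a = 1, and if a >= 2 it is at most
   (3/2)(1.21 x) ln(1.21 x)/2 because p >= 3 (the prime 2 would double this bound, so oddness
   helps), and 3/2 * 1.21/2 < 1. So it is enough that z >= x for some arbitrarily large x.

   This holds if psi(x) + psi(1.1 sqrt x) - psi(sqrt x) > x + sqrt x / 20 + K happens for every K.
   Otherwise the difference of the two sides is nonnegative, and by Landau's theorem its Mellin
   transform extends with nonnegative values to the real s > 1/2, as zeta has no real zeros there.
   But at s = 1/2 that transform has the residue 1/20 - 1/10 < 0: the term psi(1.1 sqrt x) -
   psi(sqrt x) has mean sqrt x / 10, whereas psi(x) - x contributes no pole at s = 1/2. *)

theory Submission
  imports Defs "HOL-Complex_Analysis.Complex_Analysis" "HOL-Number_Theory.Prime_Powers" "HOL-Real_Asymp.Real_Asymp"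
begin

section \<open>Landau's theorem for Laplace transforms of nonnegative functions\<close>

text \<open>Zeros of a nonzero power series are isolated, while the difference of the two series
  vanishes on a whole interval to the right of 0. Agreement is asked on one side only, because
  \<open>laplace_extend_ball\<close> compares its two series at u = c - s >= 0, where all terms of
  one of them are nonnegative.\<close>

lemma powser_unique_right:
  fixes a b :: "nat \<Rightarrow> real"
  assumes "d > 0"
    and a: "\<And>u. 0 \<le> u \<Longrightarrow> u < d \<Longrightarrow> (\<lambda>n. a n * u ^ n) sums f u"
    and b: "\<And>u. 0 \<le> u \<Longrightarrow> u < d \<Longrightarrow> (\<lambda>n. b n * u ^ n) sums f u"
  shows "a = b"
proof (rule ccontr)
  assume "a \<noteq> b"
  define c where "c n = a n - b n" for n
  have c0: "(\<lambda>n. c n * u ^ n) sums 0" if "0 \<le> u" "u < d" for u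
    using sums_diff[OF a b, OF that that] by (simp add: c_def algebra_simps)
  have cz: "c 0 = 0" using c0[of 0] \<open>d > 0\<close> by simp
  obtain m where m: "c m \<noteq> 0" using \<open>a \<noteq> b\<close> by (auto simp: c_def)
  with cz have "m > 0" by (cases m) auto
  define g where "g x = (\<Sum>n. c n * x ^ n)" for x
  have gs: "(\<lambda>n. c n * (x - 0) ^ n) sums g x" if "norm (x - 0) < d / 2" for x
    unfolding g_def diff_0_right
    by (rule summable_sums, rule powser_inside[of _ "d/2"])
      (use that c0[of "d/2"] \<open>d > 0\<close> in \<open>auto simp: sums_iff\<close>)
  have "g 0 = 0" by (simp add: g_def cz)
  then obtain s where s: "s > 0" "\<And>z. z \<in> cball 0 s - {0} \<Longrightarrow> g z \<noteq> 0"
    using powser_0_nonzero[of "d/2" 0 c g m] gs m \<open>m > 0\<close> \<open>d > 0\<close> by auto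
  define z where "z = min s (d/2)"
  have "z > 0" "z \<le> s" "z < d" using s(1) \<open>d > 0\<close> by (auto simp: z_def)
  then have "g z \<noteq> 0" by (intro s(2)) auto
  moreover have "g z = 0" unfolding g_def using c0[of z] \<open>z > 0\<close> \<open>z < d\<close> by (simp add: sums_iff)
  ultimately show False by simp
qed

text \<open>Write s = c - u and expand exp(u t) in powers of u. All terms are nonnegative, so sum
  and integral may be exchanged even before convergence is known. On a short interval the resulting
  power series agrees with the Taylor series of \<open>H\<close> at c, so the coefficients coincide;
  the Taylor series converges on the whole ball, and hence so does the integral.\<close>

lemma laplace_extend_ball:
  fixes w t :: "'a \<Rightarrow> real" and H :: "complex \<Rightarrow> complex"
  defines "F \<equiv> \<lambda>M s. \<integral>\<^sup>+x. ennreal (w x * exp (- s * t x)) \<partial>M"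
  assumes [measurable]: "w \<in> borel_measurable M" "t \<in> borel_measurable M"
    and nonneg: "\<And>x. w x \<ge> 0" "\<And>x. t x \<ge> 0"
    and hol: "H holomorphic_on ball (of_real c) r" and "r > 0" "d > 0"
    and eq: "\<And>s. c - d < s \<Longrightarrow> s \<le> c \<Longrightarrow> F M s = ennreal (Re (H (of_real s))) \<and> 0 \<le> Re (H (of_real s))"
    and s: "c - r < s" "s \<le> c"
  shows "F M s = ennreal (Re (H (of_real s))) \<and> 0 \<le> Re (H (of_real s))"
proof -
  \<comment> \<open>The moments are a priori elements of [0, \<infinity>]; their finiteness is shown
    below.\<close>
  define m where "m k = (\<integral>\<^sup>+x. ennreal (w x * exp (- c * t x) * t x ^ k) \<partial>M)" for k
  have F: "F M (c - u) = (\<Sum>k. ennreal (u ^ k / fact k) * m k)" if u: "u \<ge> 0" for u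
  proof -
    have "ennreal (w x * exp (- (c - u) * t x)) =
        (\<Sum>k. ennreal (u ^ k / fact k) * ennreal (w x * exp (- c * t x) * t x ^ k))" for x
    proof -
      have "(\<lambda>k. w x * exp (- c * t x) * ((u * t x) ^ k /\<^sub>R fact k)) sums (w x * exp (- c * t x) * exp (u * t x))"
        by (intro sums_mult exp_converges)
      also have "w x * exp (- c * t x) * exp (u * t x) = w x * exp (- (c - u) * t x)"
        by (simp add: algebra_simps flip: exp_add)
      also have "(\<lambda>k. w x * exp (- c * t x) * ((u * t x) ^ k /\<^sub>R fact k)) =
          (\<lambda>k. (u ^ k / fact k) * (w x * exp (- c * t x) * t x ^ k))"
        by (auto simp: field_simps power_mult_distrib)
      finally have "(\<Sum>k. ennreal ((u ^ k / fact k) * (w x * exp (- c * t x) * t x ^ k))) = ennreal (w x * exp (- (c - u) * t x))"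
        by (intro suminf_ennreal_eq) (use nonneg u in auto)
      moreover have "(\<Sum>k. ennreal ((u ^ k / fact k) * (w x * exp (- c * t x) * t x ^ k))) =
          (\<Sum>k. ennreal (u ^ k / fact k) * ennreal (w x * exp (- c * t x) * t x ^ k))"
        by (rule suminf_cong, rule ennreal_mult) (use nonneg u in auto)
      ultimately show ?thesis by (rule trans[OF sym])
    qed
    then have "F M (c - u) = (\<integral>\<^sup>+x. (\<Sum>k. ennreal (u ^ k / fact k) * ennreal (w x * exp (- c * t x) * t x ^ k)) \<partial>M)"
      unfolding F_def by (simp only:)
    also have "\<dots> = (\<Sum>k. ennreal (u ^ k / fact k) * m k)"
      unfolding m_def by (subst nn_integral_suminf) (auto simp: nn_integral_cmult)
    finally show ?thesis .
  qed
  define D where "D = min d r"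
  have "D > 0" using \<open>r > 0\<close> \<open>d > 0\<close> by (simp add: D_def)
  \<comment> \<open>Each single term of the expansion is bounded by its total, which is finite at
    the point c - D/2 inside the known range.\<close>
  have mfin: "m k < top" for k
  proof -
    have "F M (c - D/2) < top"
      using eq[of "c - D/2"] \<open>D > 0\<close> by (auto simp: D_def)
    also have "F M (c - D/2) = (\<Sum>k. ennreal ((D/2) ^ k / fact k) * m k)"
      by (rule F) (use \<open>D > 0\<close> in simp)
    finally have "ennreal ((D/2) ^ k / fact k) * m k < top"
      by (rule ennreal_suminf_lessD)
    then show ?thesis
      using \<open>D > 0\<close> by (auto simp: ennreal_mult_less_top)
  qed
  define a where "a k = enn2real (m k) / fact k" for k
  have a0: "a k \<ge> 0" for k by (simp add: a_def)
  have F': "F M (c - u) = (\<Sum>k. ennreal (a k * u ^ k))" if "u \<ge> 0" for u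
  proof -
    have "ennreal (u ^ k / fact k) * m k = ennreal (a k * u ^ k)" for k
    proof -
      have "m k = ennreal (enn2real (m k))" using mfin[of k] by simp
      then have "ennreal (u ^ k / fact k) * m k = ennreal (u ^ k / fact k) * ennreal (enn2real (m k))" by simp
      also have "\<dots> = ennreal (u ^ k / fact k * enn2real (m k))"
        using that by (simp flip: ennreal_mult)
      also have "u ^ k / fact k * enn2real (m k) = a k * u ^ k" by (simp add: a_def)
      finally show ?thesis .
    qed
    then show ?thesis using F[OF that] by simp
  qed
  \<comment> \<open>The sign (-1)^k appears because the Taylor series is written in u = c - s
    instead of s - c.\<close>
  define b where "b k = Re ((deriv ^^ k) H (of_real c) / fact k * (-1) ^ k)" for k
  have b: "(\<lambda>k. b k * u ^ k) sums Re (H (of_real (c - u)))" if "0 \<le> u" "u < r" for u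
  proof -
    have "(\<lambda>n. (deriv ^^ n) H (of_real c) / fact n * (of_real (c - u) - of_real c) ^ n) sums H (of_real (c - u))"
      by (rule holomorphic_power_series[OF hol]) (use that in \<open>auto simp: dist_norm\<close>)
    then have "(\<lambda>n. Re ((deriv ^^ n) H (of_real c) / fact n * (of_real (c - u) - of_real c) ^ n)) sums Re (H (of_real (c - u)))"
      by (rule sums_Re)
    moreover have "Re ((deriv ^^ n) H (of_real c) / fact n * (of_real (c - u) - of_real c) ^ n) = b n * u ^ n" for n
    proof -
      have "(of_real (c - u) - of_real c :: complex) ^ n = (-1) ^ n * of_real (u ^ n)"
        by (simp flip: power_minus)
      then have "(deriv ^^ n) H (of_real c) / fact n * (of_real (c - u) - of_real c) ^ n
          = ((deriv ^^ n) H (of_real c) / fact n * (-1) ^ n) * of_real (u ^ n)"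
        by (simp only: mult.assoc)
      then show ?thesis unfolding b_def by (simp only: times_complex.sel(1) Re_complex_of_real Im_complex_of_real mult_zero_right diff_zero)
    qed
    ultimately show ?thesis by simp
  qed
  have a: "(\<lambda>k. a k * u ^ k) sums Re (H (of_real (c - u)))" if "0 \<le> u" "u < D" for u
  proof -
    have e: "F M (c - u) = ennreal (Re (H (of_real (c - u)))) \<and> 0 \<le> Re (H (of_real (c - u)))"
      by (rule eq) (use that in \<open>auto simp: D_def\<close>)
    have "(\<lambda>k. ennreal (a k * u ^ k)) sums ennreal (Re (H (of_real (c - u))))"
      unfolding e[THEN conjunct1, symmetric] F'[OF that(1)] by (rule summable_sums) (rule summableI)
    then show ?thesis using e a0 that by (subst (asm) sums_ennreal) auto
  qed
  have "a = b"
    by (rule powser_unique_right[OF \<open>D > 0\<close> a b]) (auto simp: D_def)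
  have sm: "(\<lambda>k. a k * (c - s) ^ k) sums Re (H (of_real s))"
    using b[of "c - s"] s \<open>a = b\<close> by simp
  have nn: "0 \<le> Re (H (of_real s))"
    using sums_le[OF _ sums_zero sm] a0 s by simp
  moreover have "F M s = ennreal (Re (H (of_real s)))"
  proof -
    have "F M s = (\<Sum>k. ennreal (a k * (c - s) ^ k))"
      using F'[of "c - s"] s by simp
    also have "\<dots> = ennreal (Re (H (of_real s)))"
      by (rule suminf_ennreal_eq[OF _ sm]) (use a0 s in simp)
    finally show ?thesis .
  qed
  ultimately show ?thesis by simp
qed

text \<open>Landau's theorem: the Laplace transform of a nonnegative function converges as far to the
  left along the real axis as its analytic continuation reaches.\<close>

lemma landau_laplace:
  fixes w t :: "'a \<Rightarrow> real" and H :: "complex \<Rightarrow> complex"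
  assumes [measurable]: "w \<in> borel_measurable M" "t \<in> borel_measurable M"
    and nonneg: "\<And>x. w x \<ge> 0" "\<And>x. t x \<ge> 0"
    and hol: "\<And>s. s > s0 \<Longrightarrow> \<exists>r>0. H holomorphic_on ball (of_real s) r"
    and eq: "\<And>s. s > s1 \<Longrightarrow> (\<integral>\<^sup>+x. ennreal (w x * exp (- s * t x)) \<partial>M) = ennreal (Re (H (of_real s))) \<and> 0 \<le> Re (H (of_real s))"
    and s: "s > s0"
  shows "0 \<le> Re (H (of_real s))"
proof -
  define P where "P s \<longleftrightarrow> (\<integral>\<^sup>+x. ennreal (w x * exp (- s * t x)) \<partial>M) = ennreal (Re (H (of_real s))) \<and> 0 \<le> Re (H (of_real s))" for s
  \<comment> \<open>The infimum of \<open>A\<close> is the abscissa down to which the identity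
    holds; the clause \<open>c \<ge> s0\<close> keeps \<open>A\<close> bounded below.\<close>
  define A where "A = {c. c \<ge> s0 \<and> (\<forall>s>c. P s)}"
  have ne: "max s0 s1 \<in> A" using eq by (auto simp: A_def P_def)
  have bdd: "bdd_below A" by (auto simp: A_def bdd_below_def)
  define q where "q = Inf A"
  have q0: "q \<ge> s0" unfolding q_def by (rule cInf_greatest) (use ne in blast, simp add: A_def)
  have qP: "P s" if s: "s > q" for s
  proof -
    obtain c where c: "c \<in> A" "c < s" using cInf_lessD[of A s] ne s unfolding q_def by blast
    then show ?thesis by (simp add: A_def)
  qed
  have "q = s0"
  proof (rule ccontr)
    assume "q \<noteq> s0"
    then have "q > s0" using q0 by simp
    then obtain r where r: "r > 0" "H holomorphic_on ball (of_real q) r" using hol by blast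
    \<comment> \<open>The centre lies to the right of q, so the identity is known on (c - r/4, c] =
      (q, c]. The ball of radius r/2 about c stays inside the ball about q, yet reaches left to q -
      r/4, past the supposed abscissa.\<close>
    define c where "c = q + r / 4"
    have sub: "ball (of_real c) (r/2) \<subseteq> ball (of_real q :: complex) r"
    proof
      fix z :: complex assume "z \<in> ball (of_real c) (r/2)"
      then have "dist (of_real c) z < r/2" by simp
      moreover have "dist (of_real q) (of_real c :: complex) = r/4"
        using r by (simp add: c_def dist_norm)
      moreover have "dist (of_real q) z \<le> dist (of_real q) (of_real c :: complex) + dist (of_real c) z"
        by (rule dist_triangle)
      ultimately show "z \<in> ball (of_real q) r" using r by simp
    qed
    have "P s" if "s > c - r/2" for s
    proof (cases "s > q")
      case True then show ?thesis by (rule qP)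
    next
      case False
      show ?thesis unfolding P_def
      proof (rule laplace_extend_ball[where c = c and r = "r/2" and d = "r/4"])
        show "H holomorphic_on ball (of_real c) (r/2)" using r(2) sub by (rule holomorphic_on_subset)
      next
        fix s assume "c - r/4 < s" "s \<le> c"
        then show "(\<integral>\<^sup>+x. ennreal (w x * exp (- s * t x)) \<partial>M) = ennreal (Re (H (of_real s))) \<and> 0 \<le> Re (H (of_real s))"
          using qP[of s] by (simp add: c_def P_def)
      qed (use r that False nonneg in \<open>auto simp: c_def\<close>)
    qed
    then have "max s0 (c - r/2) \<in> A" by (auto simp: A_def)
    then have "q \<le> max s0 (c - r/2)" unfolding q_def using bdd by (rule cInf_lower)
    then show False using \<open>q > s0\<close> r by (simp add: c_def)
  qed
  then show ?thesis using qP[OF s[folded \<open>q = s0\<close>]] by (simp add: P_def)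
qed



section \<open>The function (s - 1) zeta(s) for Re s > 0 and its positivity on the real axis\<close>

definition zeta_summand :: "nat \<Rightarrow> complex \<Rightarrow> complex" where
  "zeta_summand n s = (s - 1) * of_nat n powr (- s) + (of_nat (Suc n) powr (1 - s) - of_nat n powr (1 - s))"

text \<open>This is $(s - 1)\zeta(s)$, continued to $\Re s > 0$: for $\Re s > 1$ the bracketed differences
  telescope to $0$. Since \<open>0 powr z = 0\<close>, the summand for \<open>n = 0\<close> is $1$.\<close>

definition zeta_reg :: "complex \<Rightarrow> complex" where
  "zeta_reg s = (\<Sum>n. zeta_summand n s)"

lemma has_field_derivative_of_nat_powr:
  assumes "(f has_field_derivative f') (at s)"
  shows "((\<lambda>s. (of_nat n :: complex) powr f s) has_field_derivative (of_real (ln (real n)) * of_nat n powr f s * f')) (at s)"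
proof (cases "n = 0")
  case False
  then have "of_real (ln (real n)) = Ln (of_nat n)"
    by (metis Ln_of_real of_nat_0_less_iff not_gr_zero of_real_of_nat_eq)
  then show ?thesis
    using False assms by (auto intro!: derivative_eq_intros simp: powr_def)
qed simp

text \<open>The summand is the remainder at n + 1 of the first-order Taylor expansion of z^(1-s)
  about n. The second derivative (1-s)(-s) z^(-s-1) gives the bound, which is summable over n as
  soon as Re s > 0.\<close>

lemma norm_zeta_summand_le:
  assumes "n > 0" "Re s > 0"
  shows "norm (zeta_summand n s) \<le> norm s * norm (s - 1) * real n powr (- Re s - 1)"
proof -
  define f where "f i = (if i = 0 then \<lambda>z. z powr (1 - s) else if i = 1 then \<lambda>z. (1 - s) * z powr (- s)
     else (\<lambda>z. (1 - s) * (- s) * z powr (- s - 1)))" for i :: nat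
  let ?S = "closed_segment (of_nat n) (of_nat (Suc n)) :: complex set"
  have S: "\<exists>r. x = of_real r \<and> r \<ge> real n" if x: "x \<in> ?S" for x
  proof -
    obtain u where u: "0 \<le> u" "x = (1 - u) *\<^sub>R of_nat n + u *\<^sub>R of_nat (Suc n)"
      using x unfolding in_segment(1) by (elim exE conjE) (rule that)
    have "x = of_real (real n + u)" using u by (simp add: scaleR_conv_of_real algebra_simps)
    then show ?thesis using u by (intro exI[of _ "real n + u"]) auto
  qed
  have nR: "x \<notin> \<real>\<^sub>\<le>\<^sub>0" if "x \<in> ?S" for x
    using S[OF that] assms by (auto simp: complex_nonpos_Reals_iff)
  have "norm (f 0 (of_nat (Suc n)) - (\<Sum>i\<le>1. f i (of_nat n) * (of_nat (Suc n) - of_nat n) ^ i / fact i)) \<le>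
      (norm s * norm (s - 1) * real n powr (- Re s - 1)) * norm (of_nat (Suc n) - of_nat n :: complex) ^ (Suc 1) / fact 1"
  proof (rule complex_Taylor[where S = ?S])
    fix i x assume x: "x \<in> ?S" and i: "i \<le> (1::nat)"
    have "x \<noteq> 0" using nR[OF x] by auto
    from i consider "i = 0" | "i = 1" by linarith
    then show "(f i has_field_derivative f (Suc i) x) (at x within ?S)"
    proof cases
      case 1 then show ?thesis using nR[OF x]
        by (auto simp: f_def intro!: derivative_eq_intros)
    next
      case 2 then show ?thesis using nR[OF x]
        by (auto simp: f_def intro!: derivative_eq_intros)
    qed
  next
    fix x assume "x \<in> ?S"
    then obtain r where r: "x = of_real r" "r \<ge> real n" using S by blast
    have "norm (f (Suc 1) x) = norm s * norm (s - 1) * r powr (- Re s - 1)"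
      using r by (simp add: f_def norm_mult norm_powr_real_powr norm_minus_commute)
    also have "\<dots> \<le> norm s * norm (s - 1) * real n powr (- Re s - 1)"
      using r assms by (intro mult_left_mono powr_mono2') auto
    finally show "norm (f (Suc 1) x) \<le> norm s * norm (s - 1) * real n powr (- Re s - 1)" .
  qed auto
  also have "f 0 (of_nat (Suc n)) - (\<Sum>i\<le>1. f i (of_nat n) * (of_nat (Suc n) - of_nat n) ^ i / fact i) = zeta_summand n s"
    by (simp add: f_def zeta_summand_def algebra_simps)
  finally show ?thesis by simp
qed

lemma zeta_reg_series:
  shows holomorphic_zeta_reg: "zeta_reg holomorphic_on {s. Re s > 0}"
    and zeta_summand_sums: "Re s > 0 \<Longrightarrow> (\<lambda>n. zeta_summand n s) sums zeta_reg s"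
proof -
  have op: "open {s. Re s > 0}" by (rule open_halfspace_Re_gt)
  have "\<exists>g g'. \<forall>s\<in>{s. Re s > 0}. (\<lambda>n. zeta_summand n s) sums g s \<and>
     (\<lambda>n. deriv (zeta_summand n) s) sums g' s \<and> (g has_field_derivative g' s) (at s)"
  proof (rule series_and_derivative_comparison_local[OF op])
    fix n s
    show "(zeta_summand n has_field_derivative deriv (zeta_summand n) s) (at s)"
      unfolding DERIV_deriv_iff_field_differentiable field_differentiable_def zeta_summand_def
      by (rule exI) (rule derivative_eq_intros has_field_derivative_of_nat_powr refl)+
  next
    fix s :: complex assume "s \<in> {s. Re s > 0}"
    then have s: "Re s > 0" by simp
    \<comment> \<open>With this radius every y in the ball has Re y >= d, and \<open>C\<close>
      bounds norm y * norm (y - 1), so the summands have a common summable majorant.\<close>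
    define d where "d = Re s / 2"
    define C where "C = (norm s + d) * (norm s + d + 1)"
    show "\<exists>d h. 0 < d \<and> summable h \<and> (\<forall>\<^sub>F n in sequentially. \<forall>y\<in>ball s d \<inter> {s. 0 < Re s}. norm (zeta_summand n y) \<le> h n)"
    proof (rule exI[of _ d], rule exI[of _ "\<lambda>n. C * real n powr (- d - 1)"], intro conjI)
      show "0 < d" using s by (simp add: d_def)
      show "summable (\<lambda>n. C * real n powr (- d - 1))"
        using s by (intro summable_mult) (simp add: summable_real_powr_iff d_def)
      show "\<forall>\<^sub>F n in sequentially. \<forall>y\<in>ball s d \<inter> {s. 0 < Re s}. norm (zeta_summand n y) \<le> C * real n powr (- d - 1)"
        using eventually_gt_at_top[of 0]
      proof (eventually_elim, safe)
        fix n :: nat and y assume n: "n > 0" and y: "y \<in> ball s d" "0 < Re y"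
        have "norm (y - s) < d" using y by (simp add: dist_norm norm_minus_commute)
        then have 1: "norm y \<le> norm s + d" using norm_triangle_sub[of y s] by simp
        have 2: "norm (y - 1) \<le> norm s + d + 1" using 1 norm_triangle_ineq4[of y 1] by simp
        have 3: "Re y \<ge> d"
          using \<open>norm (y - s) < d\<close> abs_Re_le_cmod[of "y - s"] by (simp add: d_def)
        have "norm (zeta_summand n y) \<le> norm y * norm (y - 1) * real n powr (- Re y - 1)"
          using n y by (intro norm_zeta_summand_le) auto
        also have "\<dots> \<le> C * real n powr (- d - 1)"
          unfolding C_def using 1 2 3 s n by (intro mult_mono powr_mono) (auto simp: d_def)
        finally show "norm (zeta_summand n y) \<le> C * real n powr (- d - 1)" .
      qed
    qed
  qed
  then obtain g g' where g: "\<And>s. Re s > 0 \<Longrightarrow> (\<lambda>n. zeta_summand n s) sums g s"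
      "\<And>s. Re s > 0 \<Longrightarrow> (g has_field_derivative g' s) (at s)" by auto
  have eq: "zeta_reg s = g s" if "Re s > 0" for s
    using g(1)[OF that] by (simp add: zeta_reg_def sums_iff)
  show "Re s > 0 \<Longrightarrow> (\<lambda>n. zeta_summand n s) sums zeta_reg s"
    using g(1) eq by simp
  have "g holomorphic_on {s. Re s > 0}"
    using g(2) op by (auto simp: holomorphic_on_open)
  then show "zeta_reg holomorphic_on {s. Re s > 0}"
    by (rule holomorphic_transform) (use eq in auto)
qed

text \<open>The term n = 0 is 1. By the mean value theorem the n-th term with n >= 1 is (1-s)(x^(-s)
  - n^(-s)) for some x between n and n + 1. For s >= 1 these are nonnegative; for s < 1 they are at
  least (1-s)((n+1)^(-s) - n^(-s)), which telescopes to s - 1, so the total is at least s. Thus zeta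
  has no real zeros to the right of 0.\<close>

lemma zeta_reg_pos:
  assumes s: "s > 0"
  shows "Re (zeta_reg (of_real s)) > 0"
proof -
  define v where "v n = (s - 1) * real n powr (- s) + (real (Suc n) powr (1 - s) - real n powr (1 - s))" for n
  have v: "zeta_summand n (of_real s) = of_real (v n)" for n
  proof -
    have *: "(of_nat m :: complex) powr (of_real y) = of_real (real m powr y)" for m y
      using powr_of_real[of "real m" y] by simp
    have "zeta_summand n (of_real s) = (of_real (s - 1)) * of_nat n powr (of_real (- s)) +
       (of_nat (Suc n) powr of_real (1 - s) - of_nat n powr of_real (1 - s))"
      by (simp add: zeta_summand_def)
    then show ?thesis unfolding * by (simp add: v_def)
  qed
  have "v sums Re (zeta_reg (of_real s))"
    using sums_Re[OF zeta_summand_sums[of "of_real s"]] s by (simp add: v)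
  moreover have "v 0 = 1" by (simp add: v_def)
  ultimately have vs: "(\<lambda>n. v (Suc n)) sums (Re (zeta_reg (of_real s)) - 1)"
    by (subst sums_Suc_iff) simp
  have mvt: "\<exists>x. real n < x \<and> x < real (Suc n) \<and> v n = (1 - s) * (x powr (- s) - real n powr (- s))" if "n > 0" for n
  proof -
    have "\<exists>z. real n < z \<and> z < real (Suc n) \<and> real (Suc n) powr (1 - s) - real n powr (1 - s) =
        (real (Suc n) - real n) * ((1 - s) * z powr (- s))"
    proof (rule MVT2)
      fix x assume "real n \<le> x"
      then have "((\<lambda>x. x powr (1 - s)) has_real_derivative (1 - s) * x powr (1 - s - 1)) (at x)"
        using that by (intro has_real_derivative_powr) auto
      then show "((\<lambda>x. x powr (1 - s)) has_real_derivative (1 - s) * x powr (- s)) (at x)" by simp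
    qed simp
    then show ?thesis unfolding v_def by (auto simp: algebra_simps)
  qed
  show ?thesis
  proof (cases "s \<ge> 1")
    case True
    have "v (Suc n) \<ge> 0" for n
    proof -
      obtain x where x: "real (Suc n) < x" "v (Suc n) = (1 - s) * (x powr (- s) - real (Suc n) powr (- s))"
        using mvt[of "Suc n"] by auto
      have "x powr (- s) \<le> real (Suc n) powr (- s)" using x s by (intro powr_mono2') auto
      then show ?thesis unfolding x(2) using True by (intro mult_nonpos_nonpos) auto
    qed
    then have "0 \<le> Re (zeta_reg (of_real s)) - 1" by (rule sums_le[OF _ sums_zero vs])
    then show ?thesis by simp
  next
    case False
    have "(\<lambda>n. (1 - s) * (real (Suc (Suc n)) powr (- s) - real (Suc n) powr (- s))) sums ((1 - s) * (0 - real (Suc 0) powr (- s)))"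
      by (intro sums_mult telescope_sums) (use s in real_asymp)
    moreover have "(1 - s) * (real (Suc (Suc n)) powr (- s) - real (Suc n) powr (- s)) \<le> v (Suc n)" for n
    proof -
      obtain x where x: "real (Suc n) < x" "x < real (Suc (Suc n))" "v (Suc n) = (1 - s) * (x powr (- s) - real (Suc n) powr (- s))"
        using mvt[of "Suc n"] by auto
      have "real (Suc (Suc n)) powr (- s) \<le> x powr (- s)" using x s by (intro powr_mono2') auto
      then show ?thesis unfolding x(3) using False by (intro mult_left_mono) auto
    qed
    ultimately have "(1 - s) * (0 - real (Suc 0) powr (- s)) \<le> Re (zeta_reg (of_real s)) - 1"
      by (intro sums_le[OF _ _ vs])
    then show ?thesis using s by simp
  qed
qed


section \<open>Dirichlet series of zeta, its derivative and its logarithmic derivative\<close>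

lemma zeta_dirichlet_series:
  assumes s: "Re s > 1"
  shows "(\<lambda>n. of_nat n powr (- s)) sums (zeta_reg s / (s - 1))"
proof -
  have s1: "s \<noteq> 1" using s by auto
  have "(\<lambda>n. (of_nat n :: complex) powr (1 - s)) \<longlonglongrightarrow> 0"
  proof (rule Lim_null_comparison[OF always_eventually])
    show "\<forall>n. norm ((of_nat n :: complex) powr (1 - s)) \<le> real n powr Re (1 - s)"
      by (simp add: norm_powr_real_powr)
    show "(\<lambda>n. real n powr Re (1 - s)) \<longlonglongrightarrow> 0"
      using s by (intro tendsto_neg_powr filterlim_real_sequentially) auto
  qed
  then have "(\<lambda>n. (of_nat (Suc n) :: complex) powr (1 - s) - of_nat n powr (1 - s)) sums (0 - of_nat 0 powr (1 - s))"
    by (rule telescope_sums)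
  then have "(\<lambda>n. zeta_summand n s - (of_nat (Suc n) powr (1 - s) - of_nat n powr (1 - s))) sums (zeta_reg s - 0)"
    using s by (intro sums_diff zeta_summand_sums) auto
  then have "(\<lambda>n. (s - 1) * of_nat n powr (- s)) sums zeta_reg s"
    by (simp add: zeta_summand_def)
  then have "(\<lambda>n. (s - 1) * of_nat n powr (- s) / (s - 1)) sums (zeta_reg s / (s - 1))"
    by (rule sums_divide)
  then show ?thesis using s1 by simp
qed

text \<open>Termwise differentiation of the series for zeta(s) =
  \<open>zeta_reg s / (s - 1)\<close>; the right-hand side is -zeta'(s) by the quotient
  rule.\<close>

lemma ln_dirichlet_series:
  assumes s: "Re s > 1"
  shows "(\<lambda>n. of_real (ln (real n)) * of_nat n powr (- s)) sums
    (zeta_reg s / (s - 1) ^ 2 - deriv zeta_reg s / (s - 1))"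
proof -
  let ?S = "{s :: complex. Re s > 1}"
  have op: "open ?S" by (rule open_halfspace_Re_gt)
  have "\<exists>g g'. \<forall>s\<in>?S. (\<lambda>n. of_nat n powr (- s)) sums g s \<and>
     (\<lambda>n. of_real (ln (real n)) * of_nat n powr (- s) * (- 1)) sums g' s \<and> (g has_field_derivative g' s) (at s)"
  proof (rule series_and_derivative_comparison_local[OF op])
    fix n and s :: complex
    show "((\<lambda>s. of_nat n powr (- s)) has_field_derivative of_real (ln (real n)) * of_nat n powr (- s) * (- 1)) (at s)"
      by (rule has_field_derivative_of_nat_powr) (auto intro!: derivative_eq_intros)
  next
    fix s :: complex assume "s \<in> ?S"
    then have s: "Re s > 1" by simp
    define d where "d = (Re s - 1) / 2"
    show "\<exists>d h. 0 < d \<and> summable h \<and> (\<forall>\<^sub>F n in sequentially. \<forall>y\<in>ball s d \<inter> ?S. norm ((of_nat n :: complex) powr (- y)) \<le> h n)"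
    proof (rule exI[of _ d], rule exI[of _ "\<lambda>n. real n powr (- (1 + d))"], intro conjI)
      show "0 < d" using s by (simp add: d_def)
      show "summable (\<lambda>n. real n powr (- (1 + d)))"
        using s by (subst summable_real_powr_iff) (simp add: d_def)
      show "\<forall>\<^sub>F n in sequentially. \<forall>y\<in>ball s d \<inter> ?S. norm ((of_nat n :: complex) powr (- y)) \<le> real n powr (- (1 + d))"
        using eventually_gt_at_top[of 0]
      proof (eventually_elim, safe)
        fix n :: nat and y assume n: "n > 0" and y: "y \<in> ball s d"
        have "norm (y - s) < d" using y by (simp add: dist_norm norm_minus_commute)
        then have "Re y \<ge> 1 + d"
          using abs_Re_le_cmod[of "y - s"] by (simp add: d_def field_simps)
        then show "norm ((of_nat n :: complex) powr (- y)) \<le> real n powr (- (1 + d))"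
          using n by (simp add: norm_powr_real_powr powr_mono)
      qed
    qed
  qed
  then obtain g g' where g: "\<And>s. Re s > 1 \<Longrightarrow> (\<lambda>n. of_nat n powr (- s)) sums g s"
      "\<And>s. Re s > 1 \<Longrightarrow> (\<lambda>n. of_real (ln (real n)) * of_nat n powr (- s) * (- 1)) sums g' s"
      "\<And>s. Re s > 1 \<Longrightarrow> (g has_field_derivative g' s) (at s)" by auto
  have eq: "zeta_reg s / (s - 1) = g s" if "Re s > 1" for s
    using g(1)[OF that] zeta_dirichlet_series[OF that] by (rule sums_unique2[symmetric])
  have "(zeta_reg has_field_derivative deriv zeta_reg s) (at s)"
    by (rule holomorphic_derivI[OF holomorphic_zeta_reg]) (use s in \<open>auto simp: open_halfspace_Re_gt\<close>)
  then have "((\<lambda>s. zeta_reg s / (s - 1)) has_field_derivative (deriv zeta_reg s * (s - 1) - zeta_reg s * 1) / ((s - 1) * (s - 1))) (at s)"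
    by (intro DERIV_divide derivative_eq_intros) (use s in auto)
  then have "(g has_field_derivative (deriv zeta_reg s * (s - 1) - zeta_reg s * 1) / ((s - 1) * (s - 1))) (at s)"
    by (rule has_field_derivative_transform_within_open[OF _ op]) (use s eq in auto)
  then have g': "g' s = (deriv zeta_reg s * (s - 1) - zeta_reg s * 1) / ((s - 1) * (s - 1))"
    using g(3)[OF s] by (rule DERIV_unique[symmetric])
  have "s - 1 \<noteq> 0" using s by auto
  then have "- g' s = zeta_reg s / (s - 1) ^ 2 - deriv zeta_reg s / (s - 1)"
    unfolding g' by (simp add: diff_divide_distrib power2_eq_square)
  then show ?thesis
    using sums_minus[OF g(2)[OF s]] by simp
qed

text \<open>This is -zeta'(s)/zeta(s). Writing it through \<open>zeta_reg\<close> isolates the pole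
  at s = 1 in the term 1/(s-1); the rest is analytic at every real s > 0.\<close>

definition neg_logderiv_zeta :: "real \<Rightarrow> real" where
  "neg_logderiv_zeta s = 1 / (s - 1) - Re (deriv zeta_reg (of_real s) / zeta_reg (of_real s))"

lemma ln_of_nat_nonneg: "ln (real n) \<ge> 0"
  by (cases "n = 0") auto

text \<open>Summing the identity that the divisors d of n have \<open>mangoldt d\<close> adding up
  to ln n, and reindexing the pairs by n = d m, factors -zeta'(s) as the wanted series times
  zeta(s). Nonnegativity of all terms justifies the rearrangement, and zeta(s) > 0 the
  division.\<close>

lemma mangoldt_dirichlet_series:
  assumes s: "s > 1"
  shows "(\<lambda>n. mangoldt n * real n powr (- s)) sums neg_logderiv_zeta s"
proof -
  \<comment> \<open>The number 0 is left out because every number divides it. Below,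
    \<open>Z\<close> and \<open>D\<close> are the real parts of zeta(s) and -zeta'(s).\<close>
  define A where "A = {0 :: nat <..}"
  define Z where "Z = Re (zeta_reg (of_real s)) / (s - 1)"
  define D where "D = Re (zeta_reg (of_real s) / (of_real s - 1) ^ 2 - deriv zeta_reg (of_real s) / (of_real s - 1))"
  have pw: "(of_nat n :: complex) powr (- of_real s) = of_real (real n powr (- s))" for n
    using powr_of_real[of "real n" "- s"] by simp
  have s1: "(of_real s - 1 :: complex) = of_real (s - 1)" by simp
  have c1: "(\<lambda>n. complex_of_real (real n powr (- s))) sums (zeta_reg (of_real s) / (of_real s - 1))"
    using zeta_dirichlet_series[of "of_real s"] s unfolding pw by simp
  \<comment> \<open>Since \<open>zeta_reg\<close> is real at real s, the real part of its
    logarithmic derivative can be taken in the numerator alone.\<close>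
  have im: "Im (zeta_reg (of_real s) / (of_real s - 1)) = 0"
    using sums_Im[OF c1] by (simp add: sums_iff)
  then have "Im (zeta_reg (of_real s) / of_real (s - 1)) = 0" by simp
  then have "Im (zeta_reg (of_real s)) = 0" unfolding Im_divide_of_real using s by simp
  then have zr: "zeta_reg (of_real s) = of_real (Re (zeta_reg (of_real s)))"
    by (simp add: complex_eq_iff)
  have Zs: "(\<lambda>n. real n powr (- s)) sums Z"
    using sums_Re[OF c1] unfolding Z_def s1 Re_divide_of_real Re_complex_of_real .
  have Ds: "(\<lambda>n. ln (real n) * real n powr (- s)) sums D"
    using sums_Re[OF ln_dirichlet_series[of "of_real s"]] s unfolding pw D_def by simp
  have Zpos: "Z > 0" unfolding Z_def using zeta_reg_pos[of s] s by simp
  have nt: "(f has_sum S) UNIV \<longleftrightarrow> (f has_sum S) A" if "f 0 = 0" for f :: "nat \<Rightarrow> real" and S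
    by (rule has_sum_cong_neutral) (use that in \<open>auto simp: A_def\<close>)
  have hs: "(f has_sum S) A" if "f sums S" "f 0 = 0" "\<And>n. f n \<ge> 0" for f :: "nat \<Rightarrow> real" and S
  proof -
    have "(f has_sum S) UNIV" using that by (intro norm_summable_imp_has_sum) (auto simp: sums_iff)
    then show ?thesis using nt[of f S] that(2) by simp
  qed
  have Zh: "((\<lambda>n. real n powr (- s)) has_sum Z) A" using Zs by (rule hs) auto
  have Dh: "((\<lambda>n. ln (real n) * real n powr (- s)) has_sum D) A"
    using Ds by (rule hs) (auto simp: ln_of_nat_nonneg)
  have inner: "((\<lambda>d. mangoldt d * real n powr (- s)) has_sum ln (real n) * real n powr (- s)) {d. d dvd n}" if "n \<in> A" for n
  proof -
    have "((\<lambda>d. mangoldt d * real n powr (- s)) has_sum (\<Sum>d | d dvd n. mangoldt d * real n powr (- s))) {d. d dvd n}"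
      by (rule has_sum_finite) (use that in \<open>auto simp: A_def\<close>)
    also have "(\<Sum>d | d dvd n. mangoldt d * real n powr (- s)) = ln (real n) * real n powr (- s)"
      using mangoldt_sum[where 'a = real, of n] that by (simp add: A_def flip: sum_distrib_right)
    finally show ?thesis .
  qed
  have sm: "(\<lambda>(n, d). mangoldt d * real n powr (- s)) summable_on (SIGMA n:A. {d. d dvd n})"
    by (rule summable_on_SigmaI[where g = "\<lambda>n. ln (real n) * real n powr (- s)"])
      (use inner Dh in \<open>auto simp: summable_on_def mangoldt_nonneg\<close>)
  have "((\<lambda>(n, d). mangoldt d * real n powr (- s)) has_sum D) (SIGMA n:A. {d. d dvd n})"
    by (rule has_sum_SigmaI[OF _ Dh sm]) (use inner in auto)
  also have "?this \<longleftrightarrow> ((\<lambda>(d, m). (mangoldt d * real d powr (- s)) * real m powr (- s)) has_sum D) (A \<times> A)"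
    by (rule has_sum_reindex_bij_witness[of _ "\<lambda>(d, m). (d * m, d)" "\<lambda>(n, d). (d, n div d)"])
      (auto simp: A_def powr_mult elim!: dvdE)
  finally have "((\<lambda>(d, m). (mangoldt d * real d powr (- s)) * real m powr (- s)) has_sum D) (A \<times> A)" .
  then have "((\<lambda>d. (mangoldt d * real d powr (- s)) * Z) has_sum D) A"
    by (rule has_sum_SigmaD) (auto intro!: has_sum_cmult_right Zh)
  then have "((\<lambda>d. (mangoldt d * real d powr (- s)) * Z * (1 / Z)) has_sum D * (1 / Z)) A"
    by (rule has_sum_cmult_left)
  then have "((\<lambda>d. mangoldt d * real d powr (- s)) has_sum D / Z) A"
    using Zpos by simp
  then have "((\<lambda>d. mangoldt d * real d powr (- s)) has_sum D / Z) UNIV"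
    using nt by simp
  then have "(\<lambda>d. mangoldt d * real d powr (- s)) sums (D / Z)"
    by (rule has_sum_imp_sums)
  moreover have "D / Z = neg_logderiv_zeta s"
  proof -
    define x where "x = Re (zeta_reg (of_real s))"
    have x: "x > 0" using zeta_reg_pos[of s] s by (simp add: x_def)
    have zx: "zeta_reg (of_real s) = of_real x" unfolding x_def by (rule zr)
    have "D = x / (s - 1) ^ 2 - Re (deriv zeta_reg (of_real s)) / (s - 1)"
      unfolding D_def s1 zx by (simp only: minus_complex.sel Re_divide_of_real Re_complex_of_real of_real_power[symmetric])
    moreover have "(x / r ^ 2 - d / r) / (x / r) = 1 / r - d / x" if "r > 0" for r d :: real
      using that x by (simp add: field_simps power2_eq_square)
    ultimately show ?thesis
      unfolding neg_logderiv_zeta_def Z_def zx using s by simp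
  qed
  ultimately show ?thesis by simp
qed



section \<open>Chebyshev's function and Mellin transforms\<close>

definition psi :: "real \<Rightarrow> real" where
  "psi x = (\<Sum>n | 0 < n \<and> real n \<le> x. mangoldt n)"

lemma finite_nat_le_real: "finite {n. 0 < n \<and> real n \<le> x}"
  by (rule finite_subset[of _ "{..nat \<lfloor>x\<rfloor>}"]) (auto simp: le_nat_floor)

lemma psi_nonneg: "psi x \<ge> 0"
  unfolding psi_def by (intro sum_nonneg mangoldt_nonneg)

lemma mono_psi: "mono psi"
  unfolding psi_def by (intro monoI sum_mono2 finite_nat_le_real mangoldt_nonneg) auto

lemma borel_measurable_psi [measurable]: "psi \<in> borel_measurable borel"
  using mono_psi by (rule borel_measurable_mono)

lemma nn_integral_powr_atLeast:
  assumes "a > 0" "s > 0"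
  shows "(\<integral>\<^sup>+x. ennreal (x powr (- s - 1)) * indicator {a..} x \<partial>lborel) = ennreal (a powr (- s) / s)"
proof -
  have "(\<integral>\<^sup>+x. ennreal (x powr (- s - 1)) * indicator {a..} x \<partial>lborel) = ennreal (0 - (- (a powr (- s) / s)))"
  proof (rule nn_integral_FTC_atLeast)
    fix x assume "a \<le> x"
    then have "((\<lambda>x. x powr (- s)) has_real_derivative - s * x powr (- s - 1)) (at x)"
      using assms by (intro has_real_derivative_powr) auto
    from DERIV_cmult[OF this, of "- (1 / s)"]
    show "((\<lambda>x. - (x powr (- s) / s)) has_real_derivative x powr (- s - 1)) (at x)"
      using assms by simp
  next
    have "((\<lambda>x. x powr (- s)) \<longlongrightarrow> 0) at_top"
      using assms by (intro tendsto_neg_powr filterlim_ident) auto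
    then have "((\<lambda>x. - (x powr (- s) / s)) \<longlongrightarrow> - (0 / s)) at_top"
      by (intro tendsto_minus tendsto_divide tendsto_const) (use assms in auto)
    then show "((\<lambda>x. - (x powr (- s) / s)) \<longlongrightarrow> 0) at_top" by simp
  qed auto
  then show ?thesis by simp
qed

lemma mellin_powr:
  fixes s b :: real
  assumes "s > b"
  shows "has_bochner_integral lborel (\<lambda>x. indicator {1..} x * (x powr b * x powr (- s - 1))) (1 / (s - b))"
proof (rule has_bochner_integral_nn_integral)
  have "ennreal (indicator {1..} x * (x powr b * x powr (- s - 1))) = ennreal (x powr (- (s - b) - 1)) * indicator {1..} x" for x :: real
    by (auto simp: indicator_def algebra_simps simp flip: powr_add)
  then show "(\<integral>\<^sup>+x. ennreal (indicator {1..} x * (x powr b * x powr (- s - 1))) \<partial>lborel) = ennreal (1 / (s - b))"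
    using nn_integral_powr_atLeast[of 1 "s - b"] assms by simp
qed (use assms in auto)

text \<open>The number n enters psi(c x^a) once x >= (n/c)^(1/a), so exchanging sum and integral
  leaves the integral of x^(-s-1) from that point on, which is c^(s/a) n^(-s/a) / s. The condition c
  < 2 puts these points at or above 1 for all n >= 2, so the integral over x >= 1 captures each
  contribution in full.\<close>

lemma mellin_psi:
  assumes c: "1 \<le> c" "c < 2" and a: "a > 0" "s > a"
  shows "has_bochner_integral lborel (\<lambda>x. indicator {1..} x * (psi (c * x powr a) * x powr (- s - 1)))
    (c powr (s / a) * neg_logderiv_zeta (s / a) / s)"
proof -
  define \<tau> where "\<tau> n = (real n / c) powr (1 / a)" for n
  have s0: "s > 0" using a by simp
  have m0: "mangoldt n = (0 :: real)" if "n < 2" for n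
  proof -
    from that have "n = 0 \<or> n = Suc 0" by auto
    then show ?thesis by auto
  qed
  have le_iff: "real n \<le> c * x powr a \<longleftrightarrow> \<tau> n \<le> x" if "x > 0" "n > 0" for x n
  proof -
    have "real n \<le> c * x powr a \<longleftrightarrow> real n / c \<le> x powr a" using c by (simp add: field_simps)
    also have "\<dots> \<longleftrightarrow> (real n / c) powr (1 / a) \<le> (x powr a) powr (1 / a)"
    proof
      assume "real n / c \<le> x powr a"
      then show "(real n / c) powr (1 / a) \<le> (x powr a) powr (1 / a)"
        by (rule powr_mono2[rotated 2]) (use c a in auto)
    next
      assume "(real n / c) powr (1 / a) \<le> (x powr a) powr (1 / a)"
      moreover have "(x powr a) powr (1 / a) < (real n / c) powr (1 / a)" if "x powr a < real n / c"
        by (rule powr_less_mono2[OF _ _ that]) (use a in auto)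
      ultimately show "real n / c \<le> x powr a" by linarith
    qed
    also have "(x powr a) powr (1 / a) = x" using that a by (simp add: powr_powr)
    finally show ?thesis by (simp add: \<tau>_def)
  qed
  have ge1: "\<tau> n \<ge> 1" if "n \<ge> 2" for n
    unfolding \<tau>_def using that c a by (intro ge_one_powr_ge_zero) (auto simp: field_simps)
  have pt: "ennreal (indicator {1..} x * (psi (c * x powr a) * x powr (- s - 1))) =
      (\<Sum>n. ennreal (mangoldt n) * (ennreal (x powr (- s - 1)) * indicator {\<tau> n..} x))" for x
  proof (cases "x \<ge> 1")
    case True
    let ?F = "{n. 0 < n \<and> real n \<le> c * x powr a}"
    have "(\<Sum>n. ennreal (mangoldt n) * (ennreal (x powr (- s - 1)) * indicator {\<tau> n..} x)) =
        (\<Sum>n\<in>?F. ennreal (mangoldt n) * (ennreal (x powr (- s - 1)) * indicator {\<tau> n..} x))"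
    proof (rule suminf_finite[OF finite_nat_le_real])
      fix n assume "n \<notin> ?F"
      then have "n = 0 \<or> \<not> \<tau> n \<le> x" using le_iff[of x n] True by auto
      then show "ennreal (mangoldt n) * (ennreal (x powr (- s - 1)) * indicator {\<tau> n..} x) = 0" by auto
    qed
    also have "\<dots> = (\<Sum>n\<in>?F. ennreal (mangoldt n * x powr (- s - 1)))"
    proof (rule sum.cong[OF refl])
      fix n assume "n \<in> ?F"
      then have "\<tau> n \<le> x" using le_iff[of x n] True by auto
      then show "ennreal (mangoldt n) * (ennreal (x powr (- s - 1)) * indicator {\<tau> n..} x) = ennreal (mangoldt n * x powr (- s - 1))"
        by (simp add: ennreal_mult mangoldt_nonneg)
    qed
    also have "\<dots> = ennreal (\<Sum>n\<in>?F. mangoldt n * x powr (- s - 1))"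
      by (rule sum_ennreal) (simp add: mangoldt_nonneg)
    finally show ?thesis using True by (simp add: psi_def sum_distrib_right)
  next
    case False
    have "ennreal (mangoldt n) * (ennreal (x powr (- s - 1)) * indicator {\<tau> n..} x) = 0" for n
      using ge1[of n] m0[of n] False by (cases "n < 2") auto
    then show ?thesis using False by (simp only: suminf_zero) simp
  qed
  have I: "ennreal (mangoldt n) * (\<integral>\<^sup>+x. ennreal (x powr (- s - 1)) * indicator {\<tau> n..} x \<partial>lborel) =
      ennreal (c powr (s / a) / s * (mangoldt n * real n powr (- (s / a))))" for n
  proof (cases "n < 2")
    case False
    then have "\<tau> n > 0" using ge1[of n] by simp
    have "ennreal (mangoldt n) * (\<integral>\<^sup>+x. ennreal (x powr (- s - 1)) * indicator {\<tau> n..} x \<partial>lborel) =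
        ennreal (mangoldt n * (\<tau> n powr (- s) / s))"
      unfolding nn_integral_powr_atLeast[OF \<open>\<tau> n > 0\<close> s0]
      by (rule ennreal_mult[symmetric]) (use s0 in \<open>simp_all add: mangoldt_nonneg\<close>)
    also have "\<tau> n powr (- s) = c powr (s / a) * real n powr (- (s / a))"
      using c False by (simp add: \<tau>_def powr_powr powr_divide powr_minus field_simps)
    finally show ?thesis by (simp add: mult_ac)
  qed (simp add: m0)
  show ?thesis
  proof (rule has_bochner_integral_nn_integral)
    have sums: "(\<lambda>n. c powr (s / a) / s * (mangoldt n * real n powr (- (s / a)))) sums (c powr (s / a) / s * neg_logderiv_zeta (s / a))"
      by (intro sums_mult mangoldt_dirichlet_series) (use a in simp)
    have "(\<integral>\<^sup>+x. ennreal (indicator {1..} x * (psi (c * x powr a) * x powr (- s - 1))) \<partial>lborel) =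
       (\<Sum>n. ennreal (mangoldt n) * (\<integral>\<^sup>+x. ennreal (x powr (- s - 1)) * indicator {\<tau> n..} x \<partial>lborel))"
      unfolding pt by (subst nn_integral_suminf) (auto simp: nn_integral_cmult)
    also have "\<dots> = ennreal (c powr (s / a) / s * neg_logderiv_zeta (s / a))"
      unfolding I by (rule suminf_ennreal_eq[OF _ sums]) (use s0 in \<open>simp add: mangoldt_nonneg\<close>)
    finally show "(\<integral>\<^sup>+x. ennreal (indicator {1..} x * (psi (c * x powr a) * x powr (- s - 1))) \<partial>lborel) =
        ennreal (c powr (s / a) * neg_logderiv_zeta (s / a) / s)" by (simp add: mult_ac)
    show "0 \<le> c powr (s / a) * neg_logderiv_zeta (s / a) / s"
      using sums_le[OF _ sums_zero sums] s0 by (simp add: mangoldt_nonneg mult_ac)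
    show "AE x in lborel. 0 \<le> indicator {1..} x * (psi (c * x powr a) * x powr (- s - 1))"
      by (simp add: psi_nonneg)
  qed measurable
qed



section \<open>Oscillation of psi(x) + psi(1.1 sqrt x) - psi(sqrt x)\<close>

lemma analytic_logderiv_zeta_reg:
  assumes "s > 0"
  shows "(\<lambda>z. deriv zeta_reg z / zeta_reg z) analytic_on {of_real s}"
proof -
  have op: "open {s :: complex. Re s > 0}" by (rule open_halfspace_Re_gt)
  have 1: "zeta_reg analytic_on {s. Re s > 0}"
    using holomorphic_zeta_reg op by (simp add: analytic_on_open)
  have 2: "deriv zeta_reg analytic_on {s. Re s > 0}"
    using 1 by (rule analytic_deriv)
  have "zeta_reg (of_real s) \<noteq> 0" using zeta_reg_pos[OF assms] by auto
  then show ?thesis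
    using assms by (intro analytic_on_divide analytic_on_subset[OF 1] analytic_on_subset[OF 2]) auto
qed

text \<open>The coefficient 1/20 may be any number below the mean coefficient 1/10 of psi(1.1 sqrt
  x) - psi(sqrt x); being positive, it later absorbs logarithmic losses. The free constant
  \<open>K\<close> later forces x to be large.\<close>

lemma exists_large_psi_shift:
  fixes K :: real
  shows "\<exists>x\<ge>1. psi x + psi (11/10 * sqrt x) - psi (sqrt x) > x + sqrt x / 20 + K"
proof (rule ccontr)
  assume "\<not> ?thesis"
  then have le: "psi x + psi (11/10 * sqrt x) - psi (sqrt x) \<le> x + sqrt x / 20 + K" if "x \<ge> 1" for x
    using that by (auto simp: not_less)
  define L where "L z = deriv zeta_reg z / zeta_reg z" for z
  \<comment> \<open>The continued Mellin transform of the difference \<open>g\<close> below. The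
    poles at s = 1 coming from x and from psi(x) have cancelled: 1/(s-1) - (1/(s-1) - L(s))/s = (1 +
    L(s))/s. The function \<open>R\<close> is its real part on the real axis.\<close>
  define H where "H s = (1 + L s + of_real K) / s + of_real (1/20) / (s - of_real (1/2))
    - (of_real (11/10) powr (of_real 2 * s) - 1) * (1 / (of_real 2 * s - 1) - L (of_real 2 * s)) / s" for s
  define R where "R s = (1 + Re (L (of_real s)) + K) / s + (1/20) / (s - 1/2)
    - ((11/10) powr (2 * s) - 1) * (1 / (2 * s - 1) - Re (L (of_real (2 * s)))) / s" for s
  have HR: "Re (H (of_real s)) = R s" if "s > 1/2" for s
  proof -
    have 1: "(1 + L (of_real s) + of_real K) / of_real s = (L (of_real s) + of_real (1 + K)) / of_real s" by simp
    have 2: "of_real (1/20) / (of_real s - of_real (1/2)) = complex_of_real ((1/20) / (s - 1/2))"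
      by (simp only: of_real_diff of_real_divide)
    have 3: "of_real (11/10) powr (of_real 2 * of_real s) - 1 = complex_of_real ((11/10) powr (2 * s) - 1)"
      using powr_of_real[of "11/10" "2 * s"] by simp
    have 4: "1 / (of_real 2 * of_real s - 1) - L (of_real 2 * of_real s) = complex_of_real (1 / (2 * s - 1)) - L (of_real (2 * s))"
      by simp
    have 5: "Re (of_real a * z) = a * Re z" for a z by simp
    show ?thesis
      unfolding H_def R_def 1 2 3 4 minus_complex.sel plus_complex.sel Re_divide_of_real Re_complex_of_real 5
      by (simp add: algebra_simps)
  qed
  have anL: "L analytic_on {of_real s}" if "s > 0" for s
    unfolding L_def using analytic_logderiv_zeta_reg[OF that] .
  have hol: "\<exists>r>0. H holomorphic_on ball (of_real s) r" if s: "s > 1/2" for s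
  proof -
    have "(L \<circ> (\<lambda>z. of_real 2 * z)) analytic_on {of_real s}"
      using anL[of "2 * s"] s by (intro analytic_on_compose analytic_intros) auto
    then have 1: "(\<lambda>z. L (of_real 2 * z)) analytic_on {of_real s}" by (simp add: o_def)
    have ne: "complex_of_real s \<noteq> 0" "complex_of_real s - of_real (1/2) \<noteq> 0" "of_real 2 * complex_of_real s - 1 \<noteq> 0"
      using s by (auto simp: complex_eq_iff)
    have 2: "(\<lambda>z. of_real (11/10) powr (of_real 2 * z)) analytic_on {of_real s}"
      by (intro analytic_intros) (auto simp: complex_nonpos_Reals_iff)
    have "H analytic_on {of_real s}"
      unfolding H_def using ne s
      by (intro analytic_on_diff analytic_on_add analytic_on_divide analytic_on_mult analytic_on_const analytic_on_ident 1 2 anL) auto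
    then show ?thesis by (auto simp: analytic_on_def)
  qed
  define g where "g x = x + sqrt x / 20 + K - (psi x + psi (11/10 * sqrt x) - psi (sqrt x))" for x
  have [measurable]: "g \<in> borel_measurable borel" unfolding g_def by measurable
  \<comment> \<open>With these choices w(x) exp(-s t(x)) = g(x) x^(-s-1) for x >= 1, which turns the
    Mellin transform into a Laplace transform; the indicators make both functions nonnegative
    everywhere.\<close>
  define w where "w x = indicator {1..} x * (g x / x)" for x :: real
  define t where "t x = indicator {1..} x * ln x" for x :: real
  have [measurable]: "w \<in> borel_measurable lborel" "t \<in> borel_measurable lborel"
    unfolding w_def t_def by measurable
  have wn: "w x \<ge> 0" and tn: "t x \<ge> 0" for x
    using le[of x] by (auto simp: w_def t_def g_def indicator_def)
  have eq: "(\<integral>\<^sup>+x. ennreal (w x * exp (- s * t x)) \<partial>lborel) = ennreal (Re (H (of_real s))) \<and> 0 \<le> Re (H (of_real s))"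
    if s: "s > 1" for s
  proof -
    let ?m = "\<lambda>f x. indicator {1..} x * (f x * x powr (- s - 1)) :: real"
    have b1: "has_bochner_integral lborel (?m (\<lambda>x. psi (1 * x powr 1))) (1 powr (s / 1) * neg_logderiv_zeta (s / 1) / s)"
      using s by (intro mellin_psi) auto
    have b2: "has_bochner_integral lborel (?m (\<lambda>x. psi (11/10 * x powr (1/2)))) ((11/10) powr (s / (1/2)) * neg_logderiv_zeta (s / (1/2)) / s)"
      using s by (intro mellin_psi) auto
    have b3: "has_bochner_integral lborel (?m (\<lambda>x. psi (1 * x powr (1/2)))) (1 powr (s / (1/2)) * neg_logderiv_zeta (s / (1/2)) / s)"
      using s by (intro mellin_psi) auto
    have b4: "has_bochner_integral lborel (?m (\<lambda>x. x powr 1)) (1 / (s - 1))"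
      using s by (intro mellin_powr) auto
    have b5: "has_bochner_integral lborel (?m (\<lambda>x. x powr (1/2))) (1 / (s - 1/2))"
      using s by (intro mellin_powr) auto
    have b6: "has_bochner_integral lborel (?m (\<lambda>x. x powr 0)) (1 / (s - 0))"
      using s by (intro mellin_powr) auto
    define I where "I = 1 / (s - 1) + 1 / 20 * (1 / (s - 1/2)) + K * (1 / (s - 0))
      - (1 powr (s / 1) * neg_logderiv_zeta (s / 1) / s + (11/10) powr (s / (1/2)) * neg_logderiv_zeta (s / (1/2)) / s
         - 1 powr (s / (1/2)) * neg_logderiv_zeta (s / (1/2)) / s)"
    have B: "has_bochner_integral lborel (\<lambda>x. ?m (\<lambda>x. x powr 1) x + 1/20 * ?m (\<lambda>x. x powr (1/2)) x + K * ?m (\<lambda>x. x powr 0) x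
        - (?m (\<lambda>x. psi (1 * x powr 1)) x + ?m (\<lambda>x. psi (11/10 * x powr (1/2))) x - ?m (\<lambda>x. psi (1 * x powr (1/2))) x)) I"
      unfolding I_def
      by (intro has_bochner_integral_diff has_bochner_integral_add has_bochner_integral_mult_right b1 b2 b3 b4 b5 b6)
    have fe: "?m (\<lambda>x. x powr 1) x + 1/20 * ?m (\<lambda>x. x powr (1/2)) x + K * ?m (\<lambda>x. x powr 0) x
        - (?m (\<lambda>x. psi (1 * x powr 1)) x + ?m (\<lambda>x. psi (11/10 * x powr (1/2))) x - ?m (\<lambda>x. psi (1 * x powr (1/2))) x)
        = w x * exp (- s * t x)" for x
    proof (cases "x \<ge> 1")
      case True
      define q where "q = x powr (- s - 1)"
      have "exp (- s * t x) = x powr (- s)" using True by (simp add: t_def powr_def)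
      also have "\<dots> = x * q" using True by (simp add: q_def powr_diff)
      finally have "w x * exp (- s * t x) = g x * q" using True by (simp add: w_def)
      moreover have "x powr (1/2) = sqrt x" using True by (simp add: powr_half_sqrt)
      ultimately show ?thesis
        unfolding q_def[symmetric] using True by (simp add: g_def algebra_simps)
    qed (simp add: w_def)
    have I1: "integrable lborel (\<lambda>x. w x * exp (- s * t x))" and I2: "(LINT x|lborel. w x * exp (- s * t x)) = I"
      using B unfolding fe by (auto simp: has_bochner_integral_iff)
    have nn: "(\<integral>\<^sup>+x. ennreal (w x * exp (- s * t x)) \<partial>lborel) = ennreal I"
      unfolding I2[symmetric] by (rule nn_integral_eq_integral[OF I1]) (simp add: wn)
    have "I \<ge> 0" unfolding I2[symmetric] by (rule integral_nonneg_AE) (simp add: wn)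
    moreover have "I = R s"
    proof -
      have "I = 1 / (s - 1) + 1 / 20 * (1 / (s - 1/2)) + K / s
        - neg_logderiv_zeta s / s - ((11/10) powr (2 * s) - 1) * neg_logderiv_zeta (2 * s) / s"
        unfolding I_def by (simp add: mult.commute right_diff_distrib diff_divide_distrib)
      also have "neg_logderiv_zeta s = 1 / (s - 1) - Re (L (of_real s))"
        by (simp add: neg_logderiv_zeta_def L_def)
      also have "neg_logderiv_zeta (2 * s) = 1 / (2 * s - 1) - Re (L (of_real (2 * s)))"
        by (simp add: neg_logderiv_zeta_def L_def)
      also have "1 / (s - 1) + 1 / 20 * (1 / (s - 1/2)) + K / s - (1 / (s - 1) - Re (L (of_real s))) / s -
          ((11/10) powr (2 * s) - 1) * (1 / (2 * s - 1) - Re (L (of_real (2 * s)))) / s = R s"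
      proof -
        have "1 / r - 1 / r / (r + 1) = 1 / (r + 1)" if "r > 0" for r :: real
          using that by (simp add: divide_simps)
        from this[of "s - 1"] have "1 / (s - 1) - (1 / (s - 1) - l) / s = (1 + l) / s" for l
          using s by (simp add: diff_divide_distrib add_divide_distrib)
        from this[of "Re (L (of_real s))"] show ?thesis unfolding R_def by (simp add: add_divide_distrib)
      qed
      finally show ?thesis .
    qed
    ultimately show ?thesis using nn HR[of s] s by simp
  qed
  have Rpos: "R s \<ge> 0" if "s > 1/2" for s
    using landau_laplace[of w lborel t "1/2" H 1 s] wn tn hol eq that HR[OF that] by simp
  define l where "l s = Re (L (of_real s))" for s
  have cl: "isCont l s" if s: "s > 0" for s
  proof -
    obtain r where "r > 0" "L holomorphic_on ball (of_real s) r"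
      using anL[OF s] by (auto simp: analytic_on_def)
    then have "isCont L (of_real s)"
      by (metis centre_in_ball continuous_on_eq_continuous_at holomorphic_on_imp_continuous_on open_ball)
    then have "isCont (\<lambda>s. L (complex_of_real s)) s"
      by (rule isCont_o2[where f = complex_of_real and g = L, rotated]) (intro continuous_of_real continuous_ident)
    then show ?thesis unfolding l_def by (intro continuous_Re)
  qed
  \<comment> \<open>This is (s - 1/2) R(s) with the simple poles at 1/2 multiplied out, so the
    formula is continuous at s = 1/2 and its value there is the residue.\<close>
  define Q where "Q s = (s - 1/2) * (1 + l s + K) / s + 1/20 - ((11/10) powr (2 * s) - 1) * (1/2 - (s - 1/2) * l (2 * s)) / s" for s
  have QR: "Q s = (s - 1/2) * R s" if "s > 1/2" for s
  proof -
    have e: "1 / (2 * s - 1) = (1/2) / (s - 1/2)" using that by (simp add: field_simps)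
    have n: "s - 1/2 \<noteq> 0" "s \<noteq> 0" using that by auto
    show ?thesis unfolding Q_def R_def l_def e using n by (simp only: ring_distribs) (simp add: divide_simps, simp add: algebra_simps)
  qed
  have "isCont (\<lambda>s. l (2 * s)) (1/2)"
    by (rule isCont_o2[where f = "(*) 2" and g = l]) (auto intro!: cl continuous_intros)
  then have "isCont Q (1/2)"
    unfolding Q_def by (intro continuous_intros cl) auto
  then have "(Q \<longlongrightarrow> Q (1/2)) (at_right (1/2))"
    by (simp add: isCont_def filterlim_at_split)
  moreover have "\<forall>\<^sub>F s in at_right (1/2). Q s \<ge> 0"
    unfolding eventually_at_right_field
    by (rule exI[of _ 1]) (auto simp: QR Rpos)
  ultimately have "Q (1/2) \<ge> 0"
    by (intro tendsto_lowerbound[of Q _ "at_right (1/2)"]) auto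
  \<comment> \<open>At s = 1/2 the power (11/10)^(2s) - 1 equals 1/10 and the factor (1/2)/s equals
    1, so the value is 1/20 - 1/10 < 0.\<close>
  then show False by (simp add: Q_def)
qed



section \<open>Divisor sums and a criterion for the inequality at a single prime\<close>

text \<open>Split the divisors by whether p^(a+1) divides them: those that it does not divide are
  the divisors of p^a M, the others are p^(a+1) times a divisor of M.\<close>

lemma sigma_prime_mult:
  assumes "prime p" "\<not> p dvd M" "M > 0"
  shows "sigma (p ^ Suc a * M) = sigma (p ^ a * M) + p ^ Suc a * sigma M"
proof -
  have p: "p > 0" using assms(1) by (rule prime_gt_0_nat)
  have eq: "{d. d dvd p ^ Suc a * M} = {d. d dvd p ^ a * M} \<union> (*) (p ^ Suc a) ` {d. d dvd M}"
  proof (intro equalityI subsetI)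
    fix d assume "d \<in> {d. d dvd p ^ Suc a * M}"
    then have d: "d dvd p ^ Suc a * M" by simp
    show "d \<in> {d. d dvd p ^ a * M} \<union> (*) (p ^ Suc a) ` {d. d dvd M}"
    proof (cases "p ^ Suc a dvd d")
      case True
      then obtain e where e: "d = p ^ Suc a * e" by (rule dvdE)
      then have "e dvd M" using d p by simp
      then show ?thesis using e by blast
    next
      case False
      obtain b c where bc: "d = b * c" "b dvd p ^ Suc a" "c dvd M" using d by (rule dvd_productE)
      obtain i where i: "i \<le> Suc a" "b = p ^ i" using bc(2) divides_primepow_nat[OF assms(1)] by blast
      have "i \<noteq> Suc a" using False bc i by auto
      then have "b dvd p ^ a" using i by (simp add: le_imp_power_dvd)
      then show ?thesis using bc by (simp add: mult_dvd_mono)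
    qed
  next
    fix d assume "d \<in> {d. d dvd p ^ a * M} \<union> (*) (p ^ Suc a) ` {d. d dvd M}"
    then show "d \<in> {d. d dvd p ^ Suc a * M}"
      by (auto simp: mult.assoc intro: dvd_mult)
  qed
  have disj: "{d. d dvd p ^ a * M} \<inter> (*) (p ^ Suc a) ` {d. d dvd M} = {}"
  proof -
    have "\<not> p ^ Suc a * e dvd p ^ a * M" for e
    proof
      assume "p ^ Suc a * e dvd p ^ a * M"
      then have "p ^ a * (p * e) dvd p ^ a * M" by (simp add: mult_ac)
      then have "p * e dvd M" using p by simp
      then show False using assms(2) by (meson dvd_mult_left)
    qed
    then show ?thesis by auto
  qed
  have "sigma (p ^ Suc a * M) = sigma (p ^ a * M) + (\<Sum>d\<in>(*) (p ^ Suc a) ` {d. d dvd M}. d)"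
    unfolding sigma_def eq by (rule sum.union_disjoint[OF _ _ disj]) (use p assms in auto)
  also have "(\<Sum>d\<in>(*) (p ^ Suc a) ` {d. d dvd M}. d) = (\<Sum>d | d dvd M. p ^ Suc a * d)"
    by (subst sum.reindex) (use p in \<open>auto simp: inj_on_def\<close>)
  finally show ?thesis by (simp add: sigma_def sum_distrib_left)
qed

lemma sigma_prime_power_mult:
  assumes "prime p" "\<not> p dvd M" "M > 0"
  shows "sigma (p ^ a * M) = (\<Sum>i\<le>a. p ^ i) * sigma M"
proof (induction a)
  case (Suc a)
  have "sigma (p ^ Suc a * M) = (\<Sum>i\<le>a. p ^ i) * sigma M + p ^ Suc a * sigma M"
    unfolding sigma_prime_mult[OF assms] Suc by (rule refl)
  then show ?case by (simp add: distrib_right)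
qed simp

text \<open>Put T = p + ... + p^(a+1) and y = ln N. Then sigma(N) = (1 + T) sigma(M) and p
  sigma(N/p) = T sigma(M), so the claim becomes T (ln y - ln z) <= ln z. Since ln y - ln z <= (y -
  z)/z = ln p / z, hypothesis \<open>S\<close> gives this.\<close>

lemma gronwall_div_prime_le:
  fixes p a M :: nat
  assumes p: "prime p" and M: "\<not> p dvd M" "M > 0" and N: "N = p ^ Suc a * M"
    and z: "z = ln (real N) - ln (real p)" "z > 1"
    and S: "(\<Sum>i\<le>a. real p ^ Suc i) * ln (real p) \<le> z * ln z"
  shows "gronwall (N div p) \<le> gronwall N"
proof -
  define T where "T = (\<Sum>i\<le>a. real p ^ Suc i)"
  have p0: "p > 1" using p by (rule prime_gt_1_nat)
  have Np: "N div p = p ^ a * M" using N p0 by simp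
  have N0: "N > 0" using N p0 M by simp
  have sg: "real (sigma M) \<ge> 0" by simp
  have s1: "real (sigma N) = (1 + T) * real (sigma M)"
    unfolding N sigma_prime_power_mult[OF p M] T_def sum.atMost_Suc_shift by (simp add: distrib_right)
  have s2: "real p * real (sigma (N div p)) = T * real (sigma M)"
    unfolding Np sigma_prime_power_mult[OF p M] T_def by (simp add: sum_distrib_left)
  have rp: "real N = real p * real (N div p)" using N Np by simp
  have lnp: "ln (real p) > 0" using p0 by simp
  have zN: "ln (real (N div p)) = z"
    unfolding z(1) rp using p0 N0 Np M by (subst ln_mult) auto
  define y where "y = ln (real N)"
  have y: "y = z + ln (real p)" using z(1) by (simp add: y_def)
  have lz: "ln z > 0" using z by simp
  have ly: "ln y > 0" using z lnp y by simp
  have "ln y - ln z = ln (y / z)" using z y lnp by (simp add: ln_div)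
  also have "\<dots> \<le> y / z - 1" using z y lnp by (intro ln_le_minus_one) simp
  also have "\<dots> = ln (real p) / z" using z(2) y by (simp add: field_simps)
  finally have d: "ln y - ln z \<le> ln (real p) / z" .
  have T0: "T \<ge> 0" unfolding T_def by (intro sum_nonneg) simp
  have "T * (ln y - ln z) \<le> T * (ln (real p) / z)" using d T0 by (rule mult_left_mono)
  also have "\<dots> = T * ln (real p) / z" by simp
  also have "\<dots> \<le> ln z" using S z(2) unfolding T_def[symmetric] by (simp add: pos_divide_le_eq mult.commute)
  finally have key: "T * ln y \<le> (1 + T) * ln z" by (simp add: algebra_simps)
  have "gronwall (N div p) = (T * real (sigma M) / real N) / ln z"
    unfolding gronwall_def zN s2[symmetric] rp using p0 by (simp add: mult.commute)
  also have "\<dots> = real (sigma M) / real N * (T / ln z)" by simp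
  also have "\<dots> \<le> real (sigma M) / real N * ((1 + T) / ln y)"
    using key lz ly by (intro mult_left_mono) (simp_all add: field_simps)
  also have "\<dots> = gronwall N"
    unfolding gronwall_def s1 y_def by simp
  finally show ?thesis .
qed

text \<open>The factor 3/2 bounds the ratio p/(p-1) of the geometric series, which is where p >= 3
  enters.\<close>

lemma sum_powers_le:
  assumes "(3 :: real) \<le> p"
  shows "(\<Sum>i\<le>a. p ^ Suc i) \<le> 3/2 * p ^ Suc a"
proof (induction a)
  case (Suc a)
  have "3/2 * p ^ Suc a \<le> 1/2 * (p * p ^ Suc a)"
    using assms by (simp add: mult_right_mono)
  then show ?case using Suc by simp
qed (use assms in simp)



section \<open>The product of odd prime powers and its size\<close>

lemma finite_primes_le_real: "finite {p::nat. prime p \<and> real p \<le> x}"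
  by (rule finite_subset[OF _ finite_nat_le_real[of x]]) (auto simp: prime_gt_0_nat)

text \<open>Identifies the exponent as the largest k with p^k <= y; the bound y >= 1 keeps the
  logarithm nonnegative, so \<open>nat\<close> does not truncate.\<close>

lemma le_nat_floor_log_iff:
  assumes "p > 1" "y \<ge> 1"
  shows "k \<le> nat \<lfloor>log (real p) y\<rfloor> \<longleftrightarrow> real (p ^ k) \<le> y"
proof -
  have "0 \<le> log (real p) y" using assms by simp
  then have "k \<le> nat \<lfloor>log (real p) y\<rfloor> \<longleftrightarrow> real k \<le> log (real p) y"
    by (simp add: le_nat_iff le_floor_iff)
  also have "\<dots> \<longleftrightarrow> real p powr real k \<le> y"
    using assms by (subst le_log_iff) auto
  finally show ?thesis using assms by (simp add: powr_realpow)
qed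

lemma mangoldt_le_mangoldt_square: "mangoldt m \<le> (mangoldt (m ^ 2) :: real)"
proof (cases "primepow m")
  case True
  then obtain p k where p: "prime p" "k > 0" "m = p ^ k" by (auto simp: primepow_def)
  then have "m ^ 2 = p ^ (k * 2)" by (simp add: power_mult)
  then show ?thesis using p by (simp add: mangoldt_primepow)
next
  case False
  then have "mangoldt m = (0 :: real)" by (simp add: mangoldt_def)
  then show ?thesis by (simp add: mangoldt_nonneg)
qed

text \<open>The prime powers $p^k \le (11/10)^2 x$ with $p \le x$ include those up to \<open>x\<close> and the
  squares of those between $\sqrt x$ and $(11/10)\sqrt x$.\<close>

lemma psi_shift_le:
  assumes x: "x \<ge> 2"
  shows "psi x + psi (11/10 * sqrt x) - psi (sqrt x) \<le>
    (\<Sum>p | prime p \<and> real p \<le> x. real (nat \<lfloor>log (real p) (121/100 * x)\<rfloor>) * ln (real p))"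
proof -
  define y where "y = 121/100 * x"
  define a where "a p = nat \<lfloor>log (real p) y\<rfloor>" for p :: nat
  define P where "P = {p::nat. prime p \<and> real p \<le> x}"
  define U where "U = {n. 0 < n \<and> real n \<le> x}"
  define V where "V = {m. sqrt x < real m \<and> real m \<le> 11/10 * sqrt x}"
  define W where "W = (\<lambda>m. m ^ 2) ` V"
  have finP: "finite P" unfolding P_def by (rule finite_primes_le_real)
  have y1: "y \<ge> 1" and xy: "x \<le> y" using x by (auto simp: y_def)
  have sx: "sqrt x > 0" using x by simp
  have V_eq: "V = {m. 0 < m \<and> real m \<le> 11/10 * sqrt x} - {m. 0 < m \<and> real m \<le> sqrt x}"
    using sx by (auto simp: V_def)
  have finU: "finite U" and finV: "finite V" and finW: "finite W"
    unfolding W_def V_eq U_def by (intro finite_imageI finite_Diff finite_nat_le_real)+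
  have "psi (11/10 * sqrt x) - psi (sqrt x) = (\<Sum>m\<in>V. mangoldt m)"
    unfolding psi_def V_eq
    by (rule sum_diff[OF finite_nat_le_real, symmetric]) (use sx in \<open>auto intro: order_trans\<close>)
  also have "\<dots> \<le> (\<Sum>m\<in>V. mangoldt (m ^ 2))"
    by (intro sum_mono mangoldt_le_mangoldt_square)
  also have "\<dots> = (\<Sum>n\<in>W. mangoldt n)"
    unfolding W_def by (subst sum.reindex) (auto simp: inj_on_def)
  finally have 1: "psi x + psi (11/10 * sqrt x) - psi (sqrt x) \<le> (\<Sum>n\<in>U. mangoldt n) + (\<Sum>n\<in>W. mangoldt n)"
    by (simp add: psi_def U_def)
  \<comment> \<open>The squares of \<open>V\<close> fall in (x, y] because (11/10)^2 = 121/100. The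
    bound m <= x holds because x >= 2 gives sqrt x >= 11/10.\<close>
  have Wb: "x < real (m ^ 2)" "real (m ^ 2) \<le> y" "real m \<le> x" if "m \<in> V" for m
  proof -
    have m: "sqrt x < real m" "real m \<le> 11/10 * sqrt x" using that by (auto simp: V_def)
    have "sqrt x ^ 2 < real m ^ 2" using m sx by (intro power_strict_mono) auto
    then show "x < real (m ^ 2)" using x by simp
    have "real m ^ 2 \<le> (11/10 * sqrt x) ^ 2" using m sx by (intro power_mono) auto
    then show "real (m ^ 2) \<le> y" using x by (simp add: y_def power_mult_distrib power2_eq_square)
    have "11/10 \<le> sqrt x" using x by (intro real_le_rsqrt) (simp add: power2_eq_square)
    then have "11/10 * sqrt x \<le> sqrt x * sqrt x" using sx by (intro mult_right_mono) auto
    also have "\<dots> = x" using x by simp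
    finally show "real m \<le> x" using m by simp
  qed
  have "U \<inter> W = {}" using Wb(1) by (force simp: U_def W_def)
  then have "(\<Sum>n\<in>U. mangoldt n) + (\<Sum>n\<in>W. mangoldt n) = (\<Sum>n\<in>U \<union> W. mangoldt n :: real)"
    by (intro sum.union_disjoint[symmetric] finU finW)
  also have "\<dots> = (\<Sum>n\<in>{n \<in> U \<union> W. primepow n}. mangoldt n)"
    by (rule sum.mono_neutral_right) (use finU finW in \<open>auto simp: mangoldt_def\<close>)
  also have "\<dots> \<le> (\<Sum>n\<in>(\<lambda>(p, k). p ^ k) ` (SIGMA p:P. {1..a p}). mangoldt n)"
  proof (rule sum_mono2)
    show "finite ((\<lambda>(p, k). p ^ k) ` (SIGMA p:P. {1..a p}))"
      using finP by (intro finite_imageI finite_SigmaI) auto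
    show "{n \<in> U \<union> W. primepow n} \<subseteq> (\<lambda>(p, k). p ^ k) ` (SIGMA p:P. {1..a p})"
    proof
      fix n assume "n \<in> {n \<in> U \<union> W. primepow n}"
      then have n: "n \<in> U \<union> W" "primepow n" by auto
      from n(2) obtain p k where p: "prime p" "k > 0" "n = p ^ k" by (auto simp: primepow_def)
      have ny: "real n \<le> y" using n(1) Wb(2) xy by (auto simp: U_def W_def)
      \<comment> \<open>Although n may exceed x, its prime may not: if n = m^2 with m in
        \<open>V\<close>, then p divides m, and m <= x.\<close>
      have "real p \<le> x"
      proof (cases "n \<in> U")
        case True
        have "p \<le> n" unfolding p(3) using p by (intro self_le_power) (auto simp: prime_gt_0_nat Suc_le_eq)
        then show ?thesis using True by (auto simp: U_def)
      next
        case False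
        then obtain m where m: "m \<in> V" "n = m ^ 2" using n(1) by (auto simp: W_def)
        have "p dvd m ^ 2" using p m(2) by (metis dvd_power)
        then have "p dvd m" using p(1) prime_dvd_power by blast
        moreover have "m > 0" using m(1) sx by (auto simp: V_def intro: gr0I)
        ultimately have "p \<le> m" by (rule dvd_imp_le)
        then show ?thesis using Wb(3)[OF m(1)] by simp
      qed
      moreover have "k \<le> a p"
        unfolding a_def using le_nat_floor_log_iff[OF prime_gt_1_nat[OF p(1)] y1] ny p(3) by simp
      ultimately show "n \<in> (\<lambda>(p, k). p ^ k) ` (SIGMA p:P. {1..a p})"
        using p by (intro image_eqI[of _ _ "(p, k)"]) (auto simp: P_def)
    qed
  qed (auto simp: mangoldt_nonneg)
  \<comment> \<open>An upper bound suffices here, and for nonnegative terms a sum over an image is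
    at most the sum over the index set.\<close>
  also have "\<dots> \<le> sum (mangoldt \<circ> (\<lambda>(p, k). p ^ k)) (SIGMA p:P. {1..a p})"
    by (rule sum_image_le) (use finP in \<open>auto simp: mangoldt_nonneg\<close>)
  also have "\<dots> = (\<Sum>p\<in>P. \<Sum>k\<in>{1..a p}. mangoldt (p ^ k))"
    using finP by (subst sum.Sigma) (auto simp: case_prod_unfold)
  also have "\<dots> = (\<Sum>p\<in>P. real (a p) * ln (real p))"
    by (intro sum.cong refl) (simp add: P_def)
  finally show ?thesis using 1 by (simp add: P_def a_def y_def)
qed



text \<open>Hypothesis \<open>slack\<close> pays for two losses: dropping the prime 2 costs at most
  ln(1.21 x), and passing from N to N/p costs at most ln x. Hypothesis \<open>square\<close> serves
  the primes with exponent at least 2, where 363/400 = (3/2)(121/100)/2. The bound x >= 5 makes N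
  composite, as both 3 and 5 divide it.\<close>

lemma GA1_odd_prime_power_prod:
  fixes x :: real
  defines "Q \<equiv> {p. prime p \<and> real p \<le> x \<and> p \<noteq> 2}"
    and "a \<equiv> \<lambda>p::nat. nat \<lfloor>log (real p) (121/100 * x)\<rfloor>"
  assumes x: "x \<ge> 5"
    and slack: "ln (121/100 * x) + ln x \<le> sqrt x / 20"
    and square: "363/400 * x * ln (121/100 * x) \<le> x * ln x"
    and large: "psi x + psi (11/10 * sqrt x) - psi (sqrt x) > x + sqrt x / 20"
  shows "odd (\<Prod>p\<in>Q. p ^ a p)" "GA1 (\<Prod>p\<in>Q. p ^ a p)" "ln (real (\<Prod>p\<in>Q. p ^ a p)) \<ge> x"
proof -
  define N where "N = (\<Prod>p\<in>Q. p ^ a p)"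
  define y where "y = 121/100 * x"
  have y: "y \<ge> 1" "x \<le> y" using x by (auto simp: y_def)
  have Qp: "prime p" "real p \<le> x" "p \<noteq> 2" if "p \<in> Q" for p using that by (auto simp: Q_def)
  have Q_eq: "{p. prime p \<and> real p \<le> x} = insert 2 Q" and "2 \<notin> Q"
    using x by (auto simp: Q_def)
  have finQ: "finite Q"
    using finite_primes_le_real[of x] unfolding Q_eq by simp
  have a_iff: "k \<le> a p \<longleftrightarrow> real (p ^ k) \<le> y" if "prime p" for p k
    unfolding a_def y_def[symmetric] by (rule le_nat_floor_log_iff[OF prime_gt_1_nat[OF that] y(1)])
  have N0: "N > 0" unfolding N_def by (rule prod_pos) (auto simp: prime_gt_0_nat dest: Qp)
  have lnN: "ln (real N) = (\<Sum>p\<in>Q. real (a p) * ln (real p))"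
    unfolding N_def of_nat_prod
    by (subst ln_prod) (auto simp: finQ prime_gt_0_nat ln_realpow dest!: Qp(1))
  \<comment> \<open>The bound from \<open>psi_shift_le\<close> includes the prime 2, which N omits;
    its share is ln(2^(a 2)) <= ln y.\<close>
  have "real (a 2) * ln 2 = ln (real (2 ^ a 2))" by (simp add: ln_realpow)
  also have "\<dots> \<le> ln y" using a_iff[of 2 "a 2"] y by simp
  finally have a2: "real (a 2) * ln 2 \<le> ln y" .
  have "psi x + psi (11/10 * sqrt x) - psi (sqrt x) \<le> (\<Sum>p\<in>insert 2 Q. real (a p) * ln (real p))"
    using psi_shift_le[of x] x unfolding Q_eq a_def by simp
  also have "\<dots> = real (a 2) * ln 2 + ln (real N)"
    using finQ \<open>2 \<notin> Q\<close> by (simp add: lnN)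
  finally have "ln (real N) > x + sqrt x / 20 - ln y" using large a2 by simp
  then have lN: "ln (real N) - ln x \<ge> x" using slack by (simp add: y_def)
  have lx: "ln x > 0" using x by simp
  show "ln (real (\<Prod>p\<in>Q. p ^ a p)) \<ge> x" using lN lx unfolding N_def[symmetric] by simp
  have dvdN: "p \<in> Q" if pN: "prime p" "p dvd N" for p
  proof -
    obtain q where q: "q \<in> Q" "p dvd q ^ a q"
      using pN finQ unfolding N_def by (auto simp: prime_dvd_prod_iff)
    then have "p dvd q" using pN(1) prime_dvd_power by blast
    then show ?thesis using q(1) Qp(1) pN(1) by (metis primes_dvd_imp_eq)
  qed
  show "odd (\<Prod>p\<in>Q. p ^ a p)"
    using dvdN[of 2] \<open>2 \<notin> Q\<close> unfolding N_def[symmetric] by auto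
  have a1: "a p \<ge> 1" if "p \<in> Q" for p
    using a_iff[of p 1] Qp[OF that] y by simp
  have inN: "p dvd N" if "p \<in> Q" for p
  proof -
    have "p dvd p ^ a p" using a1[OF that] by (simp add: dvd_power)
    then show ?thesis using that finQ unfolding N_def by (meson dvd_prod_eqI dvd_trans)
  qed
  have "composite N"
  proof -
    have 35: "3 \<in> Q" "5 \<in> Q" using x by (auto simp: Q_def)
    have "3 \<le> N" using inN[OF 35(1)] N0 by (rule dvd_imp_le)
    moreover have "\<not> prime N"
      using inN[OF 35(1)] inN[OF 35(2)] Qp(1)[OF 35(1)] Qp(1)[OF 35(2)] primes_dvd_imp_eq
      by (metis numeral_eq_iff semiring_norm(88) semiring_norm(89) num.distinct num.inject)
    ultimately show ?thesis by (simp add: composite_def)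
  qed
  moreover have "gronwall (N div p) \<le> gronwall N" if p: "prime p" "p dvd N" for p
  proof -
    have pQ: "p \<in> Q" using dvdN p by blast
    have p3: "p \<ge> 3" using Qp(3)[OF pQ] prime_ge_2_nat[OF p(1)] by simp
    obtain b where b: "a p = Suc b" using a1[OF pQ] by (cases "a p") auto
    define M where "M = (\<Prod>q\<in>Q - {p}. q ^ a q)"
    have NM: "N = p ^ Suc b * M"
      unfolding N_def M_def b[symmetric] using finQ pQ by (rule prod.remove)
    have pM: "\<not> p dvd M"
    proof
      assume "p dvd M"
      then obtain q where q: "q \<in> Q - {p}" "p dvd q ^ a q"
        using p(1) finQ unfolding M_def by (auto simp: prime_dvd_prod_iff)
      then have "p dvd q" using p(1) prime_dvd_power by blast
      then show False using q(1) Qp(1) p(1) by (metis DiffD1 DiffD2 primes_dvd_imp_eq singletonI)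
    qed
    have lp: "ln (real p) \<le> ln x" "ln (real p) > 0" using Qp(2)[OF pQ] p3 by auto
    define z where "z = ln (real N) - ln (real p)"
    have z: "z \<ge> x" using lN lp by (simp add: z_def)
    have "(\<Sum>i\<le>b. real p ^ Suc i) * ln (real p) \<le> x * ln x"
    proof (cases "b = 0")
      case True
      have "real p * ln (real p) \<le> x * ln x" using Qp(2)[OF pQ] lp x by (intro mult_mono) auto
      then show ?thesis using True by simp
    next
      case False
      have py: "real p ^ Suc b \<le> y" using a_iff[OF p(1), of "a p"] b by simp
      \<comment> \<open>The exponent b + 1 is at least 2, so p^2 <= p^(b+1) <= y and ln p is at most
        half of ln y.\<close>
      have "2 * ln (real p) \<le> real (Suc b) * ln (real p)" using False lp by (intro mult_right_mono) auto
      also have "\<dots> = ln (real p ^ Suc b)" using p3 by (simp only: ln_realpow)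
      also have "\<dots> \<le> ln y" using py p3 y by (intro ln_mono) auto
      finally have l2: "ln (real p) \<le> ln y / 2" by simp
      have "(\<Sum>i\<le>b. real p ^ Suc i) \<le> 3/2 * real p ^ Suc b" using p3 by (intro sum_powers_le) simp
      also have "\<dots> \<le> 3/2 * y" using py by simp
      finally have "(\<Sum>i\<le>b. real p ^ Suc i) * ln (real p) \<le> (3/2 * y) * (ln y / 2)"
        using l2 lp y by (intro mult_mono) auto
      also have "\<dots> = 363/400 * x * ln y" by (simp add: y_def)
      finally show ?thesis using square by (simp add: y_def)
    qed
    also have "\<dots> \<le> z * ln z" using z x by (intro mult_mono) auto
    finally show ?thesis
      by (intro gronwall_div_prime_le[OF p(1) pM _ NM z_def]) (use z x pM in \<open>auto intro: gr0I\<close>)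
  qed
  ultimately show "GA1 (\<Prod>p\<in>Q. p ^ a p)"
    unfolding N_def[symmetric] GA1_def by blast
qed

section \<open>Arbitrarily large odd GA1 numbers\<close>

lemma exists_odd_GA1_greater: "\<exists>N > B. odd N \<and> GA1 N"
proof -
  have "\<forall>\<^sub>F x :: real in at_top. ln (121/100 * x) + ln x \<le> sqrt x / 20"
    by real_asymp
  \<comment> \<open>True for large x because 363/400 < 1 while ln(1.21 x) / ln x tends to 1.\<close>
  moreover have "\<forall>\<^sub>F x :: real in at_top. 363/400 * x * ln (121/100 * x) \<le> x * ln x"
    by real_asymp
  ultimately have "\<forall>\<^sub>F x :: real in at_top. ln (121/100 * x) + ln x \<le> sqrt x / 20 \<and> 363/400 * x * ln (121/100 * x) \<le> x * ln x"
    by (rule eventually_conj)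
  then obtain X0 :: real where X0: "\<And>x. x \<ge> X0 \<Longrightarrow> ln (121/100 * x) + ln x \<le> sqrt x / 20"
      "\<And>x. x \<ge> X0 \<Longrightarrow> 363/400 * x * ln (121/100 * x) \<le> x * ln x"
    by (auto simp: eventually_at_top_linorder)
  define X where "X = max X0 (max 5 (real B))"
  \<comment> \<open>By monotonicity of \<open>psi\<close>, the left-hand side is at most this
    constant for all x <= X, so exceeding it by a positive amount forces x > X.\<close>
  define K where "K = psi X + psi (11/10 * sqrt X)"
  obtain x where x: "x \<ge> 1" "psi x + psi (11/10 * sqrt x) - psi (sqrt x) > x + sqrt x / 20 + K"
    using exists_large_psi_shift[of K] by blast
  have "x > X"
  proof (rule ccontr)
    assume "\<not> x > X"
    then have "psi x \<le> psi X" "psi (11/10 * sqrt x) \<le> psi (11/10 * sqrt X)"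
      by (auto intro!: monoD[OF mono_psi])
    then have "psi x + psi (11/10 * sqrt x) - psi (sqrt x) \<le> K"
      using psi_nonneg[of "sqrt x"] by (simp add: K_def)
    moreover have "sqrt x \<ge> 0" using x(1) by simp
    ultimately show False using x by linarith
  qed
  then have x': "x \<ge> X0" "x \<ge> 5" "x > real B" by (auto simp: X_def)
  have "K \<ge> 0" unfolding K_def by (intro add_nonneg_nonneg psi_nonneg)
  then have "psi x + psi (11/10 * sqrt x) - psi (sqrt x) > x + sqrt x / 20" using x(2) by simp
  note N = GA1_odd_prime_power_prod[OF x'(2) X0(1)[OF x'(1)] X0(2)[OF x'(1)] this]
  obtain N where N: "odd N" "GA1 N" "ln (real N) \<ge> x" using N by blast
  have "N > 0" using N(1) by (auto intro: gr0I)
  \<comment> \<open>The lower bound on ln N turns into one on N itself: B < x <= ln N < N.\<close>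
  then have "ln (real N) < real N" by (intro ln_less_self) simp
  then have "N > B" using N(3) x'(3) by simp
  then show ?thesis using N by blast
qed

theorem theorem8:
  shows "infinite {N :: nat. odd N \<and> GA1 N}"
  unfolding infinite_nat_iff_unbounded using exists_odd_GA1_greater by blast

end
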